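(* Let $(A,\searrow,\nearrow,\nwarrow,\swarrow)$ be an L-quadri-algebra and let $(A,\triangleright,\triangleleft)$, $(A,\succ,\prec)$, $(A,\vee,\wedge)$ be the associated horizontal, vertical and depth L-dendriform algebras respectively. Let $\{e_1,\dots,e_n\}$ be a basis of $A$ and $\{e_1^*,\dots,e_n^*\}$ the dual basis of $A^*$. Then $$r=\sum_{i=1}^n(e_i\otimes e_i^*-e_i^*\otimes e_i)$$ is a skew-symmetric solution of the $LD$-equation in each of the L-dendriform algebras $$A\ltimes_{L_\ast^*,-L_\nwarrow^*,-L_\wedge^*,L_\prec^*}A^*,\qquad A\ltimes_{L_\circ^*,R_\nearrow^*,R_\triangleleft^*,-R_\wedge^*}A^*,\qquad A\ltimes_{L_\bullet^*,R_\swarrow^*,-L_\triangleleft^*,-R_\prec^*}A^*,$$ formed from $(A,\triangleright,\triangleleft)$, $(A,\succ,\prec)$ and $(A,\vee,\wedge)$ respectively. Moreover, there is a natural 2-cocycle $\mathcal B$ of these L-dendriform algebras induced by $r$ via $\mathcal B(u,v)=\langle r^{-1}u,v\rangle$, which is given by $$\mathcal B(x+a^*,y+b^* )=-\langle a^*,y\rangle+\langle x,b^*\rangle,\qquad x,y\in A,\ a^*,b^*\in A^*.$$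
   Context: All algebras are finite-dimensional over a field of characteristic zero. For a bilinear product $*$ on $A$, $L_*(x)y=R_*(y)x=x*y$. For a linear map $\rho:A\to gl(V)$, $\rho^*:A\to gl(V^* )$ is defined by $\langle\rho^*(x)v^*,u\rangle=-\langle v^*,\rho(x)u\rangle$. An element $r\in W\otimes W$ is identified with the linear map $r:W^*\to W$ given by $\langle r(v^* ),u^*\rangle=\langle u^*\otimes v^*,r\rangle$ (here $W=A\oplus A^*$). For $r=\sum_ia_i\otimes b_i$, $r_{12}=\sum_ia_i\otimes b_i\otimes1$, $r_{13}=\sum_ia_i\otimes1\otimes b_i$, $r_{23}=\sum_i1\otimes a_i\otimes b_i$, with products taken componentwise ($1$ acting as a formal unit), e.g. $r_{23}*r_{13}=\sum_{i,j}a_j\otimes a_i\otimes b_i*b_j$, $r_{13}*r_{12}=\sum_{i,j}a_i*a_j\otimes b_j\otimes b_i$, $r_{23}*r_{12}=\sum_{i,j}a_j\otimes a_i*b_j\otimes b_i$. An L-dendriform algebra $(W,\triangleright,\triangleleft)$ is a vector space with two bilinear products such that for all $x,y,z$: $x\triangleright(y\triangleright z)-(x\bullet y)\triangleright z=y\triangleright(x\triangleright z)-(y\bullet x)\triangleright z$ and $x\triangleright(y\triangleleft z)-(x\triangleright y)\triangleleft z=y\triangleleft(x\bullet z)-(y\triangleleft x)\triangleleft z$, where $x\bullet y=x\triangleright y+x\triangleleft y$; put also $x\circ y=x\triangleright y-y\triangleleft x$. The $LD$-equation in $(W,\triangleright,\triangleleft)$ for $r\in W\otimes W$ is $r_{23}\triangleleft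 r_{13}=r_{13}\circ r_{12}+r_{23}\bullet r_{12}$. A 2-cocycle of $(W,\triangleright,\triangleleft)$ is a skew-symmetric bilinear form with $\mathcal B(x\triangleleft y,z)=-\mathcal B(y,z\circ x)+\mathcal B(x,z\bullet y)$. (For $(A,\succ,\prec)$ or $(A,\vee,\wedge)$ the first listed product plays the role of $\triangleright$ and the second that of $\triangleleft$; likewise, in the $LD$-equation and 2-cocycle condition $\circ,\bullet$ are those built from the products of the L-dendriform algebra under consideration.) For an L-dendriform algebra $(A,\triangleright,\triangleleft)$ and four linear maps $l_\triangleright,r_\triangleright,l_\triangleleft,r_\triangleleft:A\to gl(V)$, $A\ltimes_{l_\triangleright,r_\triangleright,l_\triangleleft,r_\triangleleft}V$ denotes $A\oplus V$ with products $(x+u)\triangleright(y+v)=x\triangleright y+l_\triangleright(x)v+r_\triangleright(y)u$ and $(x+u)\triangleleft(y+v)=x\triangleleft y+l_\triangleleft(x)v+r_\triangleleft(y)u$; the tuple $(l_\triangleright,r_\triangleright,l_\triangleleft,r_\triangleleft,V)$ is a bimodule exactly when this is an L-dendriform algebra, which holds for the three tuples in the claim. An L-quadri-algebra $(A,\searrow,\nearrow,\nwarrow,\swarrow)$ is a vector space with four bilinear products such that for all $x,y,z\in A$: $x\searrow(y\searrow z)-(x\ast y)\searrow z=y\searrow(x\searrow z)-(y\ast x)\searrow z$; $x\searrow(y\nearrow z)-(x\vee y)\nearrow z=y\nearrow(x\succ z)-(y\wedge x)\nearrow z$; $x\searrow(y\nwarrow z)-(x\searrow y)\nwarrow z=y\nwarrow(x\ast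 z)-(y\nwarrow x)\nwarrow z$; $x\nearrow(y\prec z)-(x\nearrow y)\nwarrow z=y\swarrow(x\wedge z)-(y\swarrow x)\nwarrow z$; $x\searrow(y\swarrow z)-(x\succ y)\swarrow z=y\swarrow(x\vee z)-(y\prec x)\swarrow z$; where $x\succ y=x\searrow y+x\nearrow y$, $x\prec y=x\nwarrow y+x\swarrow y$, $x\vee y=x\searrow y+x\swarrow y$, $x\wedge y=x\nearrow y+x\nwarrow y$, $x\ast y=x\searrow y+x\nearrow y+x\nwarrow y+x\swarrow y$. Its associated vertical, depth and horizontal L-dendriform algebras are $(A,\succ,\prec)$, $(A,\vee,\wedge)$ and $(A,\triangleright,\triangleleft)$, where $x\triangleright y=x\searrow y-y\nwarrow x$, $x\triangleleft y=x\nearrow y-y\swarrow x$. In the subscripts in the claim, $x\circ y=x\triangleright y-y\triangleleft x$ and $x\bullet y=x\triangleright y+x\triangleleft y$ for these horizontal products. *)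

theory Defs
  imports Complex_Main "HOL-Library.Function_Algebras" "HOL-Library.Product_Plus"
begin

text \<open>
  The dual of a vector space is not a type of its own, so vector spaces that involve it are
  represented as subspaces \<open>S\<close> of an ambient vector space that is a type with scalar
  multiplication \<open>s\<close>. Sums and differences of functions and of pairs are pointwise.
\<close>

section \<open>Duals and bilinear maps\<close>

text \<open>
  The dual of the subspace \<open>S\<close>. Functionals are set to \<open>0\<close> outside \<open>S\<close> so that
  two of them are equal iff they agree on \<open>S\<close>.
\<close>

definition dual_space :: "('k::field \<Rightarrow> 'v::ab_group_add \<Rightarrow> 'v) \<Rightarrow> 'v set \<Rightarrow> ('v \<Rightarrow> 'k) set" where
  "dual_space s S = {f. (\<forall>x\<in>S. \<forall>y\<in>S. f (x + y) = f x + f y) \<and>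
                        (\<forall>c. \<forall>x\<in>S. f (s c x) = c * f x) \<and>
                        (\<forall>x. x \<notin> S \<longrightarrow> f x = 0)}"

lemma dual_space_UNIV:
  assumes "vector_space s"
  shows "dual_space s UNIV = {f. Vector_Spaces.linear s (*) f}"
proof -
  interpret vector_space s by fact
  have k: "vector_space ((*) :: 'a \<Rightarrow> 'a \<Rightarrow> 'a)"
    by unfold_locales (auto simp: algebra_simps)
  show ?thesis
    unfolding dual_space_def Vector_Spaces.linear_def module_hom_def module_hom_axioms_def
    using assms k by (auto simp: module_iff_vector_space)
qed

definition bilinear_on ::
  "('k::field \<Rightarrow> 'v::ab_group_add \<Rightarrow> 'v) \<Rightarrow> 'v set \<Rightarrow> ('k \<Rightarrow> 'w::ab_group_add \<Rightarrow> 'w) \<Rightarrow> 'w set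
    \<Rightarrow> ('v \<Rightarrow> 'v \<Rightarrow> 'w) \<Rightarrow> bool" where
  "bilinear_on s S t T m \<longleftrightarrow>
     (\<forall>x\<in>S. \<forall>y\<in>S. m x y \<in> T) \<and>
     (\<forall>x\<in>S. \<forall>y\<in>S. \<forall>z\<in>S. m (x + y) z = m x z + m y z \<and> m x (y + z) = m x y + m x z) \<and>
     (\<forall>c. \<forall>x\<in>S. \<forall>y\<in>S. m (s c x) y = t c (m x y) \<and> m x (s c y) = t c (m x y))"

definition left_mult :: "('v \<Rightarrow> 'v \<Rightarrow> 'v) \<Rightarrow> 'v \<Rightarrow> 'v \<Rightarrow> 'v" where
  "left_mult m x y = m x y"

definition right_mult :: "('v \<Rightarrow> 'v \<Rightarrow> 'v) \<Rightarrow> 'v \<Rightarrow> 'v \<Rightarrow> 'v" where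
  "right_mult m x y = m y x"

text \<open>\<open>dual_rep \<rho>\<close> is \<open>\<rho>\<^sup>*\<close>: the value of \<open>\<rho>\<^sup>*(x) f\<close> at \<open>u\<close> is \<open>- f (\<rho>(x) u)\<close>.\<close>

definition dual_rep :: "('a \<Rightarrow> 'v \<Rightarrow> 'v) \<Rightarrow> 'a \<Rightarrow> ('v \<Rightarrow> 'k::ring) \<Rightarrow> ('v \<Rightarrow> 'k)" where
  "dual_rep \<rho> x f = (\<lambda>u. - f (\<rho> x u))"


section \<open>Tensors\<close>

text \<open>
  Tensors are multilinear forms on the dual: \<open>u \<otimes> v\<close> is the form
  \<open>(\<phi>, \<psi>) \<mapsto> \<phi>(u) \<psi>(v)\<close>, so that \<open>r \<phi> \<psi>\<close> is the pairing of
  \<open>\<phi> \<otimes> \<psi>\<close> with \<open>r\<close>. Over a field this realises the tensor product faithfully.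
\<close>

definition tensor2 ::
  "('k::field \<Rightarrow> 'v::ab_group_add \<Rightarrow> 'v) \<Rightarrow> 'v set \<Rightarrow> 'v \<Rightarrow> 'v
    \<Rightarrow> ('v \<Rightarrow> 'k) \<Rightarrow> ('v \<Rightarrow> 'k) \<Rightarrow> 'k" where
  "tensor2 s S u v = (\<lambda>\<phi> \<psi>.
     if \<phi> \<in> dual_space s S \<and> \<psi> \<in> dual_space s S then \<phi> u * \<psi> v else 0)"

definition tensor3 ::
  "('k::field \<Rightarrow> 'v::ab_group_add \<Rightarrow> 'v) \<Rightarrow> 'v set \<Rightarrow> 'v \<Rightarrow> 'v \<Rightarrow> 'v
    \<Rightarrow> ('v \<Rightarrow> 'k) \<Rightarrow> ('v \<Rightarrow> 'k) \<Rightarrow> ('v \<Rightarrow> 'k) \<Rightarrow> 'k" where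
  "tensor3 s S u v w = (\<lambda>\<phi> \<psi> \<chi>.
     if \<phi> \<in> dual_space s S \<and> \<psi> \<in> dual_space s S \<and> \<chi> \<in> dual_space s S
     then \<phi> u * \<psi> v * \<chi> w else 0)"

definition tensor_decomp ::
  "('k::field \<Rightarrow> 'v::ab_group_add \<Rightarrow> 'v) \<Rightarrow> 'v set \<Rightarrow> (('v \<Rightarrow> 'k) \<Rightarrow> ('v \<Rightarrow> 'k) \<Rightarrow> 'k)
    \<Rightarrow> nat \<Rightarrow> (nat \<Rightarrow> 'v) \<Rightarrow> (nat \<Rightarrow> 'v) \<Rightarrow> bool" where
  "tensor_decomp s S r m a b \<longleftrightarrow>
     (\<forall>i<m. a i \<in> S \<and> b i \<in> S) \<and> r = (\<Sum>i<m. tensor2 s S (a i) (b i))"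

definition tensor_square ::
  "('k::field \<Rightarrow> 'v::ab_group_add \<Rightarrow> 'v) \<Rightarrow> 'v set \<Rightarrow> (('v \<Rightarrow> 'k) \<Rightarrow> ('v \<Rightarrow> 'k) \<Rightarrow> 'k) set" where
  "tensor_square s S = {r. \<exists>m a b. tensor_decomp s S r m a b}"

definition skew_symmetric_tensor :: "(('v \<Rightarrow> 'k) \<Rightarrow> ('v \<Rightarrow> 'k) \<Rightarrow> 'k::field) \<Rightarrow> bool" where
  "skew_symmetric_tensor r \<longleftrightarrow> (\<forall>\<phi> \<psi>. r \<phi> \<psi> = - r \<psi> \<phi>)"

text \<open>The map from the dual of \<open>S\<close> to \<open>S\<close> given by \<open>r\<close>, whose value at \<open>\<psi>\<close> is determined
  by \<open>\<phi> (r(\<psi>)) = r \<phi> \<psi>\<close>.\<close>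

definition tensor_map ::
  "('k::field \<Rightarrow> 'v::ab_group_add \<Rightarrow> 'v) \<Rightarrow> 'v set \<Rightarrow> (('v \<Rightarrow> 'k) \<Rightarrow> ('v \<Rightarrow> 'k) \<Rightarrow> 'k)
    \<Rightarrow> ('v \<Rightarrow> 'k) \<Rightarrow> 'v" where
  "tensor_map s S r \<psi> = (THE w. w \<in> S \<and> (\<forall>\<phi>\<in>dual_space s S. \<phi> w = r \<phi> \<psi>))"


section \<open>L-dendriform algebras\<close>

text \<open>The arguments \<open>p\<close>, \<open>q\<close> are \<open>\<triangleright>\<close>, \<open>\<triangleleft>\<close>, in this order.\<close>

definition ld_bullet :: "('v \<Rightarrow> 'v \<Rightarrow> 'v::ab_group_add) \<Rightarrow> ('v \<Rightarrow> 'v \<Rightarrow> 'v) \<Rightarrow> 'v \<Rightarrow> 'v \<Rightarrow> 'v" where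
  "ld_bullet p q x y = p x y + q x y"

definition ld_circ :: "('v \<Rightarrow> 'v \<Rightarrow> 'v::ab_group_add) \<Rightarrow> ('v \<Rightarrow> 'v \<Rightarrow> 'v) \<Rightarrow> 'v \<Rightarrow> 'v \<Rightarrow> 'v" where
  "ld_circ p q x y = p x y - q y x"

definition L_dendriform_algebra ::
  "('k::field \<Rightarrow> 'v::ab_group_add \<Rightarrow> 'v) \<Rightarrow> 'v set
    \<Rightarrow> ('v \<Rightarrow> 'v \<Rightarrow> 'v) \<Rightarrow> ('v \<Rightarrow> 'v \<Rightarrow> 'v) \<Rightarrow> bool" where
  "L_dendriform_algebra s S p q \<longleftrightarrow>
     vector_space s \<and> module.subspace s S \<and> bilinear_on s S s S p \<and> bilinear_on s S s S q \<and>
     (\<forall>x\<in>S. \<forall>y\<in>S. \<forall>z\<in>S.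
        p x (p y z) - p (ld_bullet p q x y) z = p y (p x z) - p (ld_bullet p q y x) z \<and>
        p x (q y z) - q (p x y) z = q y (ld_bullet p q x z) - q (q y x) z)"

text \<open>
  With \<open>r = \<Sum>\<^sub>i a\<^sub>i \<otimes> b\<^sub>i\<close>, the three double sums are \<open>r\<^sub>2\<^sub>3 \<triangleleft> r\<^sub>1\<^sub>3\<close>,
  \<open>r\<^sub>1\<^sub>3 \<circ> r\<^sub>1\<^sub>2\<close> and \<open>r\<^sub>2\<^sub>3 \<bullet> r\<^sub>1\<^sub>2\<close>. They do not depend on the decomposition of \<open>r\<close>;
  the equation is required for every decomposition.
\<close>

definition LD_equation ::
  "('k::field \<Rightarrow> 'v::ab_group_add \<Rightarrow> 'v) \<Rightarrow> 'v set
    \<Rightarrow> ('v \<Rightarrow> 'v \<Rightarrow> 'v) \<Rightarrow> ('v \<Rightarrow> 'v \<Rightarrow> 'v) \<Rightarrow> (('v \<Rightarrow> 'k) \<Rightarrow> ('v \<Rightarrow> 'k) \<Rightarrow> 'k) \<Rightarrow> bool" where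
  "LD_equation s S p q r \<longleftrightarrow>
     (\<forall>m a b. tensor_decomp s S r m a b \<longrightarrow>
        (\<Sum>i<m. \<Sum>j<m. tensor3 s S (a j) (a i) (q (b i) (b j))) =
        (\<Sum>i<m. \<Sum>j<m. tensor3 s S (ld_circ p q (a i) (a j)) (b j) (b i)) +
        (\<Sum>i<m. \<Sum>j<m. tensor3 s S (a j) (ld_bullet p q (a i) (b j)) (b i)))"

definition LD_solution ::
  "('k::field \<Rightarrow> 'v::ab_group_add \<Rightarrow> 'v) \<Rightarrow> 'v set
    \<Rightarrow> ('v \<Rightarrow> 'v \<Rightarrow> 'v) \<Rightarrow> ('v \<Rightarrow> 'v \<Rightarrow> 'v) \<Rightarrow> (('v \<Rightarrow> 'k) \<Rightarrow> ('v \<Rightarrow> 'k) \<Rightarrow> 'k) \<Rightarrow> bool" where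
  "LD_solution s S p q r \<longleftrightarrow> r \<in> tensor_square s S \<and> LD_equation s S p q r"

definition two_cocycle ::
  "('k::field \<Rightarrow> 'v::ab_group_add \<Rightarrow> 'v) \<Rightarrow> 'v set
    \<Rightarrow> ('v \<Rightarrow> 'v \<Rightarrow> 'v) \<Rightarrow> ('v \<Rightarrow> 'v \<Rightarrow> 'v) \<Rightarrow> ('v \<Rightarrow> 'v \<Rightarrow> 'k) \<Rightarrow> bool" where
  "two_cocycle s S p q B \<longleftrightarrow>
     bilinear_on s S (*) UNIV B \<and>
     (\<forall>x\<in>S. \<forall>y\<in>S. B x y = - B y x) \<and>
     (\<forall>x\<in>S. \<forall>y\<in>S. \<forall>z\<in>S. B (q x y) z = - B y (ld_circ p q z x) + B x (ld_bullet p q z y))"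


section \<open>Semidirect products with the dual space\<close>

definition sum_scale ::
  "('k \<Rightarrow> 'a \<Rightarrow> 'a) \<Rightarrow> 'k::times \<Rightarrow> 'a \<times> ('a \<Rightarrow> 'k) \<Rightarrow> 'a \<times> ('a \<Rightarrow> 'k)" where
  "sum_scale s c = (\<lambda>(x, f). (s c x, \<lambda>y. c * f y))"

definition sum_carrier :: "('k::field \<Rightarrow> 'a::ab_group_add \<Rightarrow> 'a) \<Rightarrow> ('a \<times> ('a \<Rightarrow> 'k)) set" where
  "sum_carrier s = UNIV \<times> dual_space s UNIV"

text \<open>One of the two products of the semidirect product, with left action \<open>l\<close> and right action
  \<open>rr\<close>.\<close>

definition semidirect_prod ::
  "('a \<Rightarrow> 'a \<Rightarrow> 'a) \<Rightarrow> ('a \<Rightarrow> 'v \<Rightarrow> 'v) \<Rightarrow> ('a \<Rightarrow> 'v \<Rightarrow> 'v)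
    \<Rightarrow> 'a \<times> 'v::ab_group_add \<Rightarrow> 'a \<times> 'v \<Rightarrow> 'a \<times> 'v" where
  "semidirect_prod m l rr = (\<lambda>(x, u) (y, v). (m x y, l x v + rr y u))"


section \<open>L-quadri-algebras\<close>

text \<open>The four products are listed in the order \<open>\<searrow>\<close>, \<open>\<nearrow>\<close>, \<open>\<nwarrow>\<close>, \<open>\<swarrow>\<close>.\<close>

definition quadri_succ :: "('a \<Rightarrow> 'a \<Rightarrow> 'a::ab_group_add) \<Rightarrow> ('a \<Rightarrow> 'a \<Rightarrow> 'a) \<Rightarrow> ('a \<Rightarrow> 'a \<Rightarrow> 'a)
    \<Rightarrow> ('a \<Rightarrow> 'a \<Rightarrow> 'a) \<Rightarrow> 'a \<Rightarrow> 'a \<Rightarrow> 'a" where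
  "quadri_succ se ne nw sw x y = se x y + ne x y"

definition quadri_prec :: "('a \<Rightarrow> 'a \<Rightarrow> 'a::ab_group_add) \<Rightarrow> ('a \<Rightarrow> 'a \<Rightarrow> 'a) \<Rightarrow> ('a \<Rightarrow> 'a \<Rightarrow> 'a)
    \<Rightarrow> ('a \<Rightarrow> 'a \<Rightarrow> 'a) \<Rightarrow> 'a \<Rightarrow> 'a \<Rightarrow> 'a" where
  "quadri_prec se ne nw sw x y = nw x y + sw x y"

definition quadri_vee :: "('a \<Rightarrow> 'a \<Rightarrow> 'a::ab_group_add) \<Rightarrow> ('a \<Rightarrow> 'a \<Rightarrow> 'a) \<Rightarrow> ('a \<Rightarrow> 'a \<Rightarrow> 'a)
    \<Rightarrow> ('a \<Rightarrow> 'a \<Rightarrow> 'a) \<Rightarrow> 'a \<Rightarrow> 'a \<Rightarrow> 'a" where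
  "quadri_vee se ne nw sw x y = se x y + sw x y"

definition quadri_wedge :: "('a \<Rightarrow> 'a \<Rightarrow> 'a::ab_group_add) \<Rightarrow> ('a \<Rightarrow> 'a \<Rightarrow> 'a) \<Rightarrow> ('a \<Rightarrow> 'a \<Rightarrow> 'a)
    \<Rightarrow> ('a \<Rightarrow> 'a \<Rightarrow> 'a) \<Rightarrow> 'a \<Rightarrow> 'a \<Rightarrow> 'a" where
  "quadri_wedge se ne nw sw x y = ne x y + nw x y"

definition quadri_ast :: "('a \<Rightarrow> 'a \<Rightarrow> 'a::ab_group_add) \<Rightarrow> ('a \<Rightarrow> 'a \<Rightarrow> 'a) \<Rightarrow> ('a \<Rightarrow> 'a \<Rightarrow> 'a)
    \<Rightarrow> ('a \<Rightarrow> 'a \<Rightarrow> 'a) \<Rightarrow> 'a \<Rightarrow> 'a \<Rightarrow> 'a" where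
  "quadri_ast se ne nw sw x y = se x y + ne x y + nw x y + sw x y"

definition quadri_right :: "('a \<Rightarrow> 'a \<Rightarrow> 'a::ab_group_add) \<Rightarrow> ('a \<Rightarrow> 'a \<Rightarrow> 'a) \<Rightarrow> ('a \<Rightarrow> 'a \<Rightarrow> 'a)
    \<Rightarrow> ('a \<Rightarrow> 'a \<Rightarrow> 'a) \<Rightarrow> 'a \<Rightarrow> 'a \<Rightarrow> 'a" where
  "quadri_right se ne nw sw x y = se x y - nw y x"

definition quadri_left :: "('a \<Rightarrow> 'a \<Rightarrow> 'a::ab_group_add) \<Rightarrow> ('a \<Rightarrow> 'a \<Rightarrow> 'a) \<Rightarrow> ('a \<Rightarrow> 'a \<Rightarrow> 'a)
    \<Rightarrow> ('a \<Rightarrow> 'a \<Rightarrow> 'a) \<Rightarrow> 'a \<Rightarrow> 'a \<Rightarrow> 'a" where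
  "quadri_left se ne nw sw x y = ne x y - sw y x"

definition L_quadri_algebra ::
  "('k::field \<Rightarrow> 'a::ab_group_add \<Rightarrow> 'a) \<Rightarrow> ('a \<Rightarrow> 'a \<Rightarrow> 'a) \<Rightarrow> ('a \<Rightarrow> 'a \<Rightarrow> 'a) \<Rightarrow> ('a \<Rightarrow> 'a \<Rightarrow> 'a)
    \<Rightarrow> ('a \<Rightarrow> 'a \<Rightarrow> 'a) \<Rightarrow> bool" where
  "L_quadri_algebra s se ne nw sw \<longleftrightarrow>
     (let succ = quadri_succ se ne nw sw; prec = quadri_prec se ne nw sw;
          vee = quadri_vee se ne nw sw; wedge = quadri_wedge se ne nw sw;
          ast = quadri_ast se ne nw sw
      in vector_space s \<and>
         bilinear_on s UNIV s UNIV se \<and> bilinear_on s UNIV s UNIV ne \<and>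
         bilinear_on s UNIV s UNIV nw \<and> bilinear_on s UNIV s UNIV sw \<and>
         (\<forall>x y z.
            se x (se y z) - se (ast x y) z = se y (se x z) - se (ast y x) z \<and>
            se x (ne y z) - ne (vee x y) z = ne y (succ x z) - ne (wedge y x) z \<and>
            se x (nw y z) - nw (se x y) z = nw y (ast x z) - nw (nw y x) z \<and>
            ne x (prec y z) - nw (ne x y) z = sw y (wedge x z) - nw (sw y x) z \<and>
            se x (sw y z) - sw (succ x y) z = sw y (vee x z) - sw (prec y x) z))"

end

theory Submission
  imports Defs
begin

text \<open>
  Put \<open>W = A \<oplus> A\<^sup>*\<close>. The map given by \<open>r\<close> sends the functional
  \<open>(y, b) \<mapsto> b x - a y\<close> to \<open>(x, a)\<close>, so it is bijective and its inverse is
  \<open>B\<close>. For a skew-symmetric bijective \<open>r\<close> the LD-equation is the 2-cocycle condition for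
  \<open>B\<close>, and this in turn splits into three identities between the products of \<open>A\<close> and
  the operations whose duals act on \<open>A\<^sup>*\<close>. Being an L-dendriform algebra likewise
  becomes five identities on \<open>A\<close>, each a signed sum of instances of the
  L-quadri-algebra axioms.
\<close>

section \<open>Linear and bilinear maps on subspaces\<close>

lemma sum_fun_apply: "(\<Sum>i\<in>I. F i) x = (\<Sum>i\<in>I. F i x)"
  for F :: "'i \<Rightarrow> 'b \<Rightarrow> 'c::comm_monoid_add"
  by (induction I rule: infinite_finite_induct) auto

lemma dual_spaceD:
  assumes "\<phi> \<in> dual_space s S" "x \<in> S"
  shows "y \<in> S \<Longrightarrow> \<phi> (x + y) = \<phi> x + \<phi> y" "\<phi> (s c x) = c * \<phi> x"
  using assms by (auto simp: dual_space_def)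

lemma bilinear_on_add:
  assumes "vector_space t" "module.subspace t T" "bilinear_on s S t T m" "bilinear_on s S t T m'"
  shows "bilinear_on s S t T (\<lambda>x y. m x y + m' x y)"
proof -
  interpret vector_space t by fact
  show ?thesis
    using assms by (auto simp: bilinear_on_def subspace_add algebra_simps)
qed

lemma bilinear_on_uminus:
  assumes "vector_space t" "module.subspace t T" "bilinear_on s S t T m"
  shows "bilinear_on s S t T (\<lambda>x y. - m x y)"
proof -
  interpret vector_space t by fact
  show ?thesis
    using assms by (auto simp: bilinear_on_def subspace_neg algebra_simps)
qed

lemma bilinear_on_diff:
  assumes "vector_space t" "module.subspace t T" "bilinear_on s S t T m" "bilinear_on s S t T m'"
  shows "bilinear_on s S t T (\<lambda>x y. m x y - m' x y)"
  using bilinear_on_add[OF assms(1-3) bilinear_on_uminus[OF assms(1,2,4)]] by simp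

lemma bilinear_on_flip:
  "bilinear_on s S t T m \<Longrightarrow> bilinear_on s S t T (\<lambda>x y. m y x)"
  by (auto simp: bilinear_on_def)

lemma bilinear_on_functional:
  assumes "bilinear_on s S s S m" "\<chi> \<in> dual_space s S"
  shows "bilinear_on s S (*) UNIV (\<lambda>x y. \<chi> (m x y))"
  using assms by (auto simp: bilinear_on_def dual_spaceD)

locale subspace_of = vector_space s for s :: "'k::field \<Rightarrow> 'v::ab_group_add \<Rightarrow> 'v" +
  fixes S :: "'v set"
  assumes subspace: "subspace S"
begin

lemma functional_zero: "\<phi> \<in> dual_space s S \<Longrightarrow> \<phi> 0 = 0"
  using dual_spaceD(2)[of \<phi> s S 0 0] subspace_0[OF subspace] by simp

lemma functional_neg: "\<phi> \<in> dual_space s S \<Longrightarrow> x \<in> S \<Longrightarrow> \<phi> (- x) = - \<phi> x"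
  using dual_spaceD(2)[of \<phi> s S x "- 1"] by simp

lemma functional_diff:
  "\<phi> \<in> dual_space s S \<Longrightarrow> x \<in> S \<Longrightarrow> y \<in> S \<Longrightarrow> \<phi> (x - y) = \<phi> x - \<phi> y"
  using dual_spaceD(1)[of \<phi> s S x "- y"] functional_neg[of \<phi> y] subspace_neg[OF subspace] by simp

lemma functional_sum:
  assumes "\<phi> \<in> dual_space s S" "\<And>i. i \<in> I \<Longrightarrow> x i \<in> S"
  shows "\<phi> (\<Sum>i\<in>I. s (c i) (x i)) = (\<Sum>i\<in>I. c i * \<phi> (x i))"
  using assms(2)
proof (induction I rule: infinite_finite_induct)
  case (insert i I)
  have "(\<Sum>i\<in>I. s (c i) (x i)) \<in> S"
    using insert.prems by (intro subspace_sum[OF subspace] subspace_scale[OF subspace]) auto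
  then show ?case
    using insert by (simp add: dual_spaceD[OF assms(1)] subspace_scale[OF subspace])
qed (auto simp: functional_zero[OF assms(1)])

text \<open>Collapses the double sums of the LD-equation: paired with functionals, each becomes a
  bilinear form evaluated at two contractions of the tensor.\<close>

lemma bilinear_sum:
  assumes "bilinear_on s S (*) UNIV G" and "\<And>i. i \<in> I \<Longrightarrow> x i \<in> S" and "\<And>j. j \<in> J \<Longrightarrow> y j \<in> S"
  shows "G (\<Sum>i\<in>I. s (c i) (x i)) (\<Sum>j\<in>J. s (d j) (y j)) = (\<Sum>i\<in>I. \<Sum>j\<in>J. c i * d j * G (x i) (y j))"
proof -
  have Y: "(\<Sum>j\<in>J. s (d j) (y j)) \<in> S"
    using assms(3) by (intro subspace_sum[OF subspace] subspace_scale[OF subspace]) auto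
  \<comment> \<open>Members of \<open>dual_space\<close> vanish outside \<open>S\<close>, so the
    partial maps of \<open>G\<close> are cut off before \<open>functional_sum\<close> is applied in
    each slot.\<close>
  have D: "(\<lambda>x. if x \<in> S then G x v else 0) \<in> dual_space s S"
    "(\<lambda>x. if x \<in> S then G v x else 0) \<in> dual_space s S" if "v \<in> S" for v
    using assms(1) that subspace_add[OF subspace] subspace_scale[OF subspace]
    by (auto simp: dual_space_def bilinear_on_def)
  have X: "(\<Sum>i\<in>I. s (c i) (x i)) \<in> S"
    using assms(2) by (intro subspace_sum[OF subspace] subspace_scale[OF subspace]) auto
  have "G (\<Sum>i\<in>I. s (c i) (x i)) (\<Sum>j\<in>J. s (d j) (y j))
      = (\<Sum>i\<in>I. c i * G (x i) (\<Sum>j\<in>J. s (d j) (y j)))"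
    using functional_sum[OF D(1)[OF Y], of I x c] assms(2) X by simp
  also have "\<dots> = (\<Sum>i\<in>I. c i * (\<Sum>j\<in>J. d j * G (x i) (y j)))"
  proof (rule sum.cong[OF refl])
    fix i assume "i \<in> I"
    then show "c i * G (x i) (\<Sum>j\<in>J. s (d j) (y j)) = c i * (\<Sum>j\<in>J. d j * G (x i) (y j))"
      using functional_sum[OF D(2), of "x i" J y d] assms(2,3) Y by simp
  qed
  finally show ?thesis
    by (simp add: sum_distrib_left mult.assoc)
qed

end


section \<open>The LD-equation as a 2-cocycle condition\<close>

text \<open>
  Writing \<open>T\<close> for the map given by a skew-symmetric \<open>r\<close>, the LD-equation paired with
  \<open>(\<phi>, \<psi>, \<chi>)\<close> reads
  \<open>\<chi> (T \<psi> \<triangleleft> T \<phi>) = \<phi> (T \<chi> \<circ> T \<psi>) - \<psi> (T \<chi> \<bullet> T \<phi>)\<close>,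
  which is the cocycle condition for \<open>B u v = (T\<^sup>-\<^sup>1 u) v\<close>.
\<close>

lemma (in subspace_of) LD_equation_if_two_cocycle:
  assumes p: "bilinear_on s S s S p" and q: "bilinear_on s S s S q"
    and separating: "\<And>w. w \<in> S \<Longrightarrow> (\<And>\<phi>. \<phi> \<in> dual_space s S \<Longrightarrow> \<phi> w = 0) \<Longrightarrow> w = 0"
    and skew: "skew_symmetric_tensor r"
    and T: "\<And>\<psi>. \<psi> \<in> dual_space s S \<Longrightarrow> T \<psi> \<in> S"
      "\<And>\<phi> \<psi>. \<phi> \<in> dual_space s S \<Longrightarrow> \<psi> \<in> dual_space s S \<Longrightarrow> \<phi> (T \<psi>) = r \<phi> \<psi>"
    and B: "\<And>\<psi> v. \<psi> \<in> dual_space s S \<Longrightarrow> v \<in> S \<Longrightarrow> B (T \<psi>) v = \<psi> v"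
    and cocycle: "two_cocycle s S p q B"
  shows "LD_equation s S p q r"
  unfolding LD_equation_def
proof (intro allI impI ext)
  fix m a b \<phi> \<psi> \<chi>
  assume decomp: "tensor_decomp s S r m a b"
  then have ab: "\<And>i. i < m \<Longrightarrow> a i \<in> S" "\<And>i. i < m \<Longrightarrow> b i \<in> S"
    and r: "r = (\<Sum>i<m. tensor2 s S (a i) (b i))"
    by (auto simp: tensor_decomp_def)
  let ?D = "dual_space s S"
  note closed = subspace_add[OF subspace] subspace_diff[OF subspace] subspace_neg[OF subspace]
    subspace_scale[OF subspace] subspace_sum[OF subspace]
  have r_eq: "r \<phi> \<psi> = (\<Sum>i<m. \<phi> (a i) * \<psi> (b i))" if "\<phi> \<in> ?D" "\<psi> \<in> ?D" for \<phi> \<psi>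
    using that by (simp add: r sum_fun_apply tensor2_def)
  \<comment> \<open>Contracting the second leg of \<open>r\<close> recovers \<open>T\<close>. Only
    the values \<open>\<phi> (T \<psi>)\<close> are known, so equality is tested against all
    functionals.\<close>
  have T_right: "(\<Sum>i<m. s (\<psi> (b i)) (a i)) = T \<psi>" if \<psi>: "\<psi> \<in> ?D" for \<psi>
  proof -
    have "(\<Sum>i<m. s (\<psi> (b i)) (a i)) - T \<psi> = 0"
    proof (rule separating)
      show "(\<Sum>i<m. s (\<psi> (b i)) (a i)) - T \<psi> \<in> S"
        using ab T(1)[OF \<psi>] by (auto intro!: closed)
      fix \<phi> assume \<phi>: "\<phi> \<in> ?D"
      have "(\<Sum>i<m. s (\<psi> (b i)) (a i)) \<in> S"
        using ab by (auto intro!: closed)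
      then show "\<phi> ((\<Sum>i<m. s (\<psi> (b i)) (a i)) - T \<psi>) = 0"
        using ab functional_sum[OF \<phi>, of "{..<m}" a "\<lambda>i. \<psi> (b i)"]
        by (simp add: functional_diff[OF \<phi>] T \<psi> \<phi> r_eq mult.commute)
    qed
    then show ?thesis by simp
  qed
  \<comment> \<open>Contracting the first leg swaps the arguments of \<open>r\<close>, and
    skew-symmetry turns this into a sign. Written as a scalar, the sign can be pulled out by
    \<open>scal\<close> below.\<close>
  have T_left: "(\<Sum>i<m. s (\<psi> (a i)) (b i)) = s (- 1) (T \<psi>)" if \<psi>: "\<psi> \<in> ?D" for \<psi>
  proof -
    have "(\<Sum>i<m. s (\<psi> (a i)) (b i)) + T \<psi> = 0"
    proof (rule separating)
      show "(\<Sum>i<m. s (\<psi> (a i)) (b i)) + T \<psi> \<in> S"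
        using ab T(1)[OF \<psi>] by (auto intro!: closed)
      fix \<phi> assume \<phi>: "\<phi> \<in> ?D"
      have "(\<Sum>i<m. s (\<psi> (a i)) (b i)) \<in> S"
        using ab by (auto intro!: closed)
      moreover have "(\<Sum>i<m. \<psi> (a i) * \<phi> (b i)) = - r \<phi> \<psi>"
        by (rule trans[OF r_eq[OF \<psi> \<phi>, symmetric]
              skew[unfolded skew_symmetric_tensor_def, rule_format]])
      ultimately show "\<phi> ((\<Sum>i<m. s (\<psi> (a i)) (b i)) + T \<psi>) = 0"
        using ab functional_sum[OF \<phi>, of "{..<m}" b "\<lambda>i. \<psi> (a i)"]
        by (simp add: dual_spaceD[OF \<phi>] T \<psi> \<phi>)
    qed
    then show ?thesis by (simp add: add_eq_0_iff2 add_eq_0_iff)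
  qed
  show "(\<Sum>i<m. \<Sum>j<m. tensor3 s S (a j) (a i) (q (b i) (b j))) \<phi> \<psi> \<chi> =
        ((\<Sum>i<m. \<Sum>j<m. tensor3 s S (ld_circ p q (a i) (a j)) (b j) (b i)) +
        (\<Sum>i<m. \<Sum>j<m. tensor3 s S (a j) (ld_bullet p q (a i) (b j)) (b i))) \<phi> \<psi> \<chi>"
  proof (cases "\<phi> \<in> ?D \<and> \<psi> \<in> ?D \<and> \<chi> \<in> ?D")
    \<comment> \<open>\<open>tensor3\<close> is 0 by convention once an argument lies outside the
      dual space, so both sides vanish.\<close>
    case False
    then show ?thesis
      by (auto simp: sum_fun_apply tensor3_def)
  next
    case True
    then have \<phi>: "\<phi> \<in> ?D" and \<psi>: "\<psi> \<in> ?D" and \<chi>: "\<chi> \<in> ?D" by auto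
    note TS = T(1)[OF \<phi>] T(1)[OF \<psi>] T(1)[OF \<chi>]
    have scal: "G (s c x) (s d y) = c * d * G x y"
      if "bilinear_on s S (*) UNIV G" "x \<in> S" "y \<in> S" for G c d x y
      using that subspace_scale[OF subspace] by (auto simp: bilinear_on_def)
    have circ: "bilinear_on s S s S (ld_circ p q)"
      using bilinear_on_diff[OF vector_space_axioms subspace p bilinear_on_flip[OF q]]
      by (simp add: ld_circ_def[abs_def])
    have bullet: "bilinear_on s S s S (ld_bullet p q)"
      using bilinear_on_add[OF vector_space_axioms subspace p q] by (simp add: ld_bullet_def[abs_def])
    have qS: "q (T \<psi>) (T \<phi>) \<in> S"
      using q TS by (auto simp: bilinear_on_def)
    \<comment> \<open>Each contraction of a first leg costs a sign: two in the first sum, none in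
      the second, one in the third.\<close>
    have 1: "(\<Sum>i<m. \<Sum>j<m. \<phi> (a j) * \<psi> (a i) * \<chi> (q (b i) (b j))) = \<chi> (q (T \<psi>) (T \<phi>))"
      using bilinear_sum[OF bilinear_on_functional[OF q \<chi>],
        of "{..<m}" b "{..<m}" b
          "\<lambda>i. \<psi> (a i)" "\<lambda>i. \<phi> (a i)"]
        scal[OF bilinear_on_functional[OF q \<chi>] TS(2,1), of "- 1" "- 1"] ab
      by (simp only: T_left \<phi> \<psi> lessThan_iff) (simp add: mult_ac)
    have 2: "(\<Sum>i<m. \<Sum>j<m. \<phi> (ld_circ p q (a i) (a j)) * \<psi> (b j) * \<chi> (b i)) =
        \<phi> (ld_circ p q (T \<chi>) (T \<psi>))"
      using bilinear_sum[OF bilinear_on_functional[OF circ \<phi>],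
        of "{..<m}" a "{..<m}" a
          "\<lambda>i. \<chi> (b i)" "\<lambda>i. \<psi> (b i)"] ab
      by (simp only: T_right \<chi> \<psi> lessThan_iff) (simp add: mult_ac)
    have 3: "(\<Sum>i<m. \<Sum>j<m. \<phi> (a j) * \<psi> (ld_bullet p q (a i) (b j)) * \<chi> (b i)) =
        - \<psi> (ld_bullet p q (T \<chi>) (T \<phi>))"
      using bilinear_sum[OF bilinear_on_functional[OF bullet \<psi>],
        of "{..<m}" a "{..<m}" b
          "\<lambda>i. \<chi> (b i)" "\<lambda>i. \<phi> (a i)"]
        scal[OF bilinear_on_functional[OF bullet \<psi>] TS(3,1), of 1 "- 1"] ab
      by (simp only: T_left T_right \<chi> \<phi> lessThan_iff) (simp add: mult_ac)
    have S: "ld_circ p q (T \<chi>) (T \<psi>) \<in> S" "ld_bullet p q (T \<chi>) (T \<phi>) \<in> S"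
      using circ bullet TS by (auto simp: bilinear_on_def)
    have "\<chi> (q (T \<psi>) (T \<phi>)) = \<phi> (ld_circ p q (T \<chi>) (T \<psi>)) - \<psi> (ld_bullet p q (T \<chi>) (T \<phi>))"
    proof -
      \<comment> \<open>The cocycle condition has \<open>T \<chi>\<close> in the second slot;
        skew-symmetry moves it to the first, where \<open>B\<close> evaluates to
        \<open>\<chi>\<close>.\<close>
      have "B (T \<chi>) (q (T \<psi>) (T \<phi>)) = - B (q (T \<psi>) (T \<phi>)) (T \<chi>)"
        using cocycle TS qS unfolding two_cocycle_def by blast
      also have "B (q (T \<psi>) (T \<phi>)) (T \<chi>) =
          - B (T \<phi>) (ld_circ p q (T \<chi>) (T \<psi>)) + B (T \<psi>) (ld_bullet p q (T \<chi>) (T \<phi>))"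
        using cocycle TS unfolding two_cocycle_def by blast
      finally show ?thesis
        using B qS S \<phi> \<psi> \<chi> by simp
    qed
    then show ?thesis
      using True by (simp add: sum_fun_apply tensor3_def 1 2 3)
  qed
qed


section \<open>Semidirect products with the dual space\<close>

locale dual_sum = vector_space s for s :: "'k::field \<Rightarrow> 'a::ab_group_add \<Rightarrow> 'a"
begin

abbreviation "D \<equiv> dual_space s UNIV"
abbreviation "sW \<equiv> sum_scale s"
abbreviation "W \<equiv> sum_carrier s"

sublocale A: subspace_of s UNIV
  by unfold_locales (rule subspace_UNIV)

lemma functional:
  assumes "f \<in> D"
  shows "f (x + y) = f x + f y" "f (x - y) = f x - f y" "f (- x) = - f x" "f (s c x) = c * f x"
  using dual_spaceD[OF assms] A.functional_diff[OF assms] A.functional_neg[OF assms] by auto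

lemma D_zero: "0 \<in> D"
  by (auto simp: dual_space_def)

lemma D_add: "f \<in> D \<Longrightarrow> g \<in> D \<Longrightarrow> f + g \<in> D"
  by (auto simp: dual_space_def algebra_simps)

lemma D_diff: "f \<in> D \<Longrightarrow> g \<in> D \<Longrightarrow> f - g \<in> D"
  by (auto simp: dual_space_def algebra_simps)

lemma D_scale: "f \<in> D \<Longrightarrow> (\<lambda>y. c * f y) \<in> D"
  by (auto simp: dual_space_def algebra_simps)

lemma D_dual_rep: "bilinear_on s UNIV s UNIV m \<Longrightarrow> f \<in> D \<Longrightarrow> dual_rep m x f \<in> D"
  by (auto simp: dual_space_def bilinear_on_def dual_rep_def)

lemma mem_W: "(x, f) \<in> W \<longleftrightarrow> f \<in> D"
  by (simp add: sum_carrier_def)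

text \<open>In the ambient type the second component is an arbitrary function; \<open>W\<close>
  keeps the linear ones, so linear algebra on it goes through \<open>subspace_of\<close>.\<close>

lemma subspace_of_W: "subspace_of sW W"
proof -
  interpret sum: vector_space sW
    by unfold_locales
      (auto simp: sum_scale_def fun_eq_iff algebra_simps split: prod.splits, metis distrib_left)
  show ?thesis
    by unfold_locales
      (auto simp: sum.subspace_def sum_carrier_def sum_scale_def zero_prod_def
        D_zero D_add D_scale split: prod.splits)
qed

sublocale W: subspace_of sW W
  by (rule subspace_of_W)

end

text \<open>One setting for all three semidirect products: \<open>\<alpha>\<close>,
  \<open>\<beta>\<close>, \<open>\<gamma>\<close>, \<open>\<delta>\<close> absorb the signs and the
  choice between left and right multiplication. The actions are compared with dual representations
  on \<open>D\<close> only, because moving a sign inside requires an additive functional.\<close>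

locale dual_semidirect = dual_sum s for s :: "'k::field \<Rightarrow> 'a::ab_group_add \<Rightarrow> 'a" +
  fixes p q \<alpha> \<beta> \<gamma> \<delta> :: "'a \<Rightarrow> 'a \<Rightarrow> 'a"
    and l1 r1 l2 r2 :: "'a \<Rightarrow> ('a \<Rightarrow> 'k) \<Rightarrow> ('a \<Rightarrow> 'k)"
  assumes bilinear: "bilinear_on s UNIV s UNIV p" "bilinear_on s UNIV s UNIV q"
      "bilinear_on s UNIV s UNIV \<alpha>" "bilinear_on s UNIV s UNIV \<beta>"
      "bilinear_on s UNIV s UNIV \<gamma>" "bilinear_on s UNIV s UNIV \<delta>"
    and rep: "\<And>x f. f \<in> D \<Longrightarrow> l1 x f = dual_rep \<alpha> x f" "\<And>x f. f \<in> D \<Longrightarrow> r1 x f = dual_rep \<beta> x f"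
      "\<And>x f. f \<in> D \<Longrightarrow> l2 x f = dual_rep \<gamma> x f" "\<And>x f. f \<in> D \<Longrightarrow> r2 x f = dual_rep \<delta> x f"
begin

abbreviation "P \<equiv> semidirect_prod p l1 r1"
abbreviation "Q \<equiv> semidirect_prod q l2 r2"

lemma P_eq: "f \<in> D \<Longrightarrow> g \<in> D \<Longrightarrow> P (x, f) (y, g) = (p x y, dual_rep \<alpha> x g + dual_rep \<beta> y f)"
  and Q_eq: "f \<in> D \<Longrightarrow> g \<in> D \<Longrightarrow> Q (x, f) (y, g) = (q x y, dual_rep \<gamma> x g + dual_rep \<delta> y f)"
  by (simp_all add: semidirect_prod_def rep)

lemmas rep_D = bilinear(3-6)[THEN D_dual_rep]

lemmas mult_simps = bilinear(1-6)[unfolded bilinear_on_def, simplified]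

lemma bilinear_P: "bilinear_on sW W sW W P" and bilinear_Q: "bilinear_on sW W sW W Q"
  unfolding bilinear_on_def sum_carrier_def
  by (auto simp: P_eq Q_eq rep_D D_add D_scale sum_scale_def)
    (auto simp: mult_simps functional dual_rep_def fun_eq_iff algebra_simps)

text \<open>
  Transposing the bimodule axioms: \<open>C1\<close> and \<open>C2\<close> come from the first L-dendriform axiom with the
  dual element in the place of \<open>z\<close> resp. \<open>x\<close> (the axiom is symmetric in \<open>x\<close> and \<open>y\<close>), and
  \<open>C3\<close>, \<open>C4\<close>, \<open>C5\<close> from the second one with it in the place of \<open>z\<close>, \<open>y\<close>, \<open>x\<close>.
\<close>

lemma L_dendriform:
  assumes "L_dendriform_algebra s UNIV p q"
    and C1: "\<And>x y u. \<alpha> y (\<alpha> x u) + \<alpha> (ld_bullet p q x y) u =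
      \<alpha> x (\<alpha> y u) + \<alpha> (ld_bullet p q y x) u"
    and C2: "\<And>y z u. - (\<beta> (p y z) u + \<beta> y (\<beta> z u) + \<delta> y (\<beta> z u)) =
      \<beta> z (\<alpha> y u) - (\<alpha> y (\<beta> z u) + \<gamma> y (\<beta> z u))"
    and C3: "\<And>x y u. \<gamma> y (\<alpha> x u) + \<gamma> (p x y) u = \<alpha> x (\<gamma> y u) + \<gamma> x (\<gamma> y u) + \<gamma> (q y x) u"
    and C4: "\<And>x z u. \<delta> z (\<alpha> x u) - \<alpha> x (\<delta> z u) = - (\<delta> (ld_bullet p q x z) u + \<delta> x (\<delta> z u))"
    and C5: "\<And>y z u. - (\<beta> (q y z) u + \<beta> y (\<delta> z u)) =
      \<beta> z (\<gamma> y u) + \<delta> z (\<gamma> y u) - \<gamma> y (\<delta> z u)"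
  shows "L_dendriform_algebra sW W P Q"
proof -
  have D1: "p x (p y z) - p (ld_bullet p q x y) z = p y (p x z) - p (ld_bullet p q y x) z"
    and D2: "p x (q y z) - q (p x y) z = q y (ld_bullet p q x z) - q (q y x) z" for x y z
    using assms(1) by (auto simp: L_dendriform_algebra_def)
  note C = C1 C2 C3 C4 C5
  have bullet: "ld_bullet P Q (x, f) (y, g) =
      (ld_bullet p q x y, (dual_rep \<alpha> x g + dual_rep \<beta> y f) + (dual_rep \<gamma> x g + dual_rep \<delta> y f))"
    if "f \<in> D" "g \<in> D" for x y f g
    using that by (simp add: ld_bullet_def P_eq Q_eq)
  show ?thesis
    unfolding L_dendriform_algebra_def
  proof (intro conjI ballI)
    show "vector_space sW" "module.subspace sW W"
      by (rule W.vector_space_axioms W.subspace)+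
    show "bilinear_on sW W sW W P" "bilinear_on sW W sW W Q"
      by (rule bilinear_P bilinear_Q)+
    fix X Y Z assume "X \<in> W" "Y \<in> W" "Z \<in> W"
    then obtain x f y g z h where eq: "X = (x, f)" "Y = (y, g)" "Z = (z, h)"
      and [simp]: "f \<in> D" "g \<in> D" "h \<in> D"
      by (auto simp: sum_carrier_def)
    show "P X (P Y Z) - P (ld_bullet P Q X Y) Z = P Y (P X Z) - P (ld_bullet P Q Y X) Z"
      (is "?L = ?R")
    proof (rule prod_eqI)
      show "fst ?L = fst ?R"
        unfolding eq by (simp add: P_eq bullet rep_D D_add D1)
      show "snd ?L = snd ?R"
      proof (rule ext)
        fix u
        \<comment> \<open>At \<open>u\<close> the second component is a sum of contributions of
          \<open>f\<close>, \<open>g\<close> and \<open>h\<close>. \<open>C1\<close> settles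
          \<open>h\<close>; \<open>C2\<close> settles \<open>f\<close> and, read with
          \<open>x\<close> for \<open>y\<close>, also \<open>g\<close>.\<close>
        have "h (\<alpha> y (\<alpha> x u) + \<alpha> (ld_bullet p q x y) u) = h (\<alpha> x (\<alpha> y u) + \<alpha> (ld_bullet p q y x) u)"
          "f (- (\<beta> (p y z) u + \<beta> y (\<beta> z u) + \<delta> y (\<beta> z u))) =
            f (\<beta> z (\<alpha> y u) - (\<alpha> y (\<beta> z u) + \<gamma> y (\<beta> z u)))"
          "g (- (\<beta> (p x z) u + \<beta> x (\<beta> z u) + \<delta> x (\<beta> z u))) =
            g (\<beta> z (\<alpha> x u) - (\<alpha> x (\<beta> z u) + \<gamma> x (\<beta> z u)))"
          by (simp_all only: C)
        note this[unfolded functional[OF \<open>f \<in> D\<close>] functional[OF \<open>g \<in> D\<close>] functional[OF \<open>h \<in> D\<close>]]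
        then show "snd ?L u = snd ?R u"
          unfolding eq by (simp add: P_eq bullet rep_D D_add) (simp add: dual_rep_def, algebra)
      qed
    qed
    show "P X (Q Y Z) - Q (P X Y) Z = Q Y (ld_bullet P Q X Z) - Q (Q Y X) Z"
      (is "?L = ?R")
    proof (rule prod_eqI)
      show "fst ?L = fst ?R"
        unfolding eq by (simp add: P_eq Q_eq bullet rep_D D_add D2)
      show "snd ?L = snd ?R"
      proof (rule ext)
        fix u
        have "h (\<gamma> y (\<alpha> x u) + \<gamma> (p x y) u) = h (\<alpha> x (\<gamma> y u) + \<gamma> x (\<gamma> y u) + \<gamma> (q y x) u)"
          "g (\<delta> z (\<alpha> x u) - \<alpha> x (\<delta> z u)) = g (- (\<delta> (ld_bullet p q x z) u + \<delta> x (\<delta> z u)))"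
          "f (- (\<beta> (q y z) u + \<beta> y (\<delta> z u))) =
            f (\<beta> z (\<gamma> y u) + \<delta> z (\<gamma> y u) - \<gamma> y (\<delta> z u))"
          by (simp_all only: C)
        note this[unfolded functional[OF \<open>f \<in> D\<close>] functional[OF \<open>g \<in> D\<close>] functional[OF \<open>h \<in> D\<close>]]
        then show "snd ?L u = snd ?R u"
          unfolding eq by (simp add: P_eq Q_eq bullet rep_D D_add) (simp add: dual_rep_def, algebra)
      qed
    qed
  qed
qed

text \<open>
  \<open>K1\<close>, \<open>K2\<close>, \<open>K3\<close> are the cocycle identity with two arguments in \<open>A\<close> and the dual
  element in the place of \<open>z\<close>, \<open>y\<close>, \<open>x\<close>.
\<close>

lemma two_cocycle:
  assumes K1: "\<And>x y. q x y = \<beta> x y - \<gamma> x y - \<beta> y x - \<delta> y x"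
    and K2: "\<And>x z. \<gamma> x z = ld_circ p q z x - \<alpha> z x - \<gamma> z x"
    and K3: "\<And>y z. \<delta> y z = \<alpha> z y - \<delta> z y - ld_bullet p q z y"
    and B: "\<And>x y a b. a \<in> D \<Longrightarrow> b \<in> D \<Longrightarrow> B (x, a) (y, b) = - a y + b x"
  shows "two_cocycle sW W P Q B"
  unfolding two_cocycle_def
proof (intro conjI ballI)
  show "bilinear_on sW W (*) UNIV B"
    unfolding bilinear_on_def sum_carrier_def
    by (auto simp: B D_add D_scale sum_scale_def functional algebra_simps)
  fix X Y assume X: "X \<in> W" and Y: "Y \<in> W"
  show "B X Y = - B Y X"
    using X Y by (auto simp: B sum_carrier_def)
  fix Z assume "Z \<in> W"
  then obtain x f y g z h where eq: "X = (x, f)" "Y = (y, g)" "Z = (z, h)"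
    and [simp]: "f \<in> D" "g \<in> D" "h \<in> D"
    using X Y by (auto simp: sum_carrier_def)
  have "h (q x y) = h (\<beta> x y - \<gamma> x y - \<beta> y x - \<delta> y x)"
    "g (\<gamma> x z) = g (ld_circ p q z x - \<alpha> z x - \<gamma> z x)"
    "f (\<delta> y z) = f (\<alpha> z y - \<delta> z y - ld_bullet p q z y)"
    by (simp_all only: K1[symmetric] K2[symmetric] K3[symmetric])
  note this[unfolded functional[OF \<open>f \<in> D\<close>] functional[OF \<open>g \<in> D\<close>] functional[OF \<open>h \<in> D\<close>]
      ld_circ_def ld_bullet_def]
  then show "B (Q X Y) Z = - B Y (ld_circ P Q Z X) + B X (ld_bullet P Q Z Y)"
    unfolding eq
    by (simp add: P_eq Q_eq B ld_circ_def ld_bullet_def rep_D D_add D_diff)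
      (simp add: dual_rep_def functional)
qed

end


section \<open>The canonical skew-symmetric tensor\<close>

locale dual_basis = dual_sum s for s :: "'k::field \<Rightarrow> 'a::ab_group_add \<Rightarrow> 'a" +
  fixes n :: nat and e :: "nat \<Rightarrow> 'a" and e_dual :: "nat \<Rightarrow> 'a \<Rightarrow> 'k"
  assumes inj: "inj_on e {1..n}"
    and spanning: "span (e ` {1..n}) = UNIV"
    and e_dual_D: "\<And>i. i \<in> {1..n} \<Longrightarrow> e_dual i \<in> D"
    and e_dual_e: "\<And>i j. i \<in> {1..n} \<Longrightarrow> j \<in> {1..n} \<Longrightarrow> e_dual i (e j) = (if i = j then 1 else 0)"
begin

abbreviation "DW \<equiv> dual_space sW W"

definition r :: "('a \<times> ('a \<Rightarrow> 'k) \<Rightarrow> 'k) \<Rightarrow> ('a \<times> ('a \<Rightarrow> 'k) \<Rightarrow> 'k) \<Rightarrow> 'k" where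
  "r = (\<Sum>i=1..n. tensor2 sW W (e i, 0) (0, e_dual i) - tensor2 sW W (0, e_dual i) (e i, 0))"

text \<open>The closed form of the cocycle, cut off outside \<open>W\<close> so that
  \<open>pairing u\<close> belongs to \<open>DW\<close>. It turns out to be the inverse of
  \<open>tensor_map\<close>.\<close>

definition pairing :: "'a \<times> ('a \<Rightarrow> 'k) \<Rightarrow> 'a \<times> ('a \<Rightarrow> 'k) \<Rightarrow> 'k" where
  "pairing u v = (if v \<in> W then snd v (fst u) - snd u (fst v) else 0)"

text \<open>Spanning provides some coefficients, and applying \<open>e_dual i\<close> identifies
  them.\<close>

lemma expansion: "x = (\<Sum>i=1..n. s (e_dual i x) (e i))"
proof -
  have "x \<in> span (e ` {1..n})"
    using spanning by simp
  then obtain c where "x = (\<Sum>v\<in>e ` {1..n}. s (c v) v)"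
    by (auto simp: span_finite)
  then have x: "x = (\<Sum>i=1..n. s (c (e i)) (e i))"
    by (simp add: sum.reindex[OF inj] del: One_nat_def)
  have "e_dual i x = c (e i)" if i: "i \<in> {1..n}" for i
  proof -
    have "e_dual i x = (\<Sum>j=1..n. c (e j) * e_dual i (e j))"
      by (subst x, rule A.functional_sum[OF e_dual_D[OF i]]) simp
    also have "\<dots> = (\<Sum>j=1..n. if i = j then c (e j) else 0)"
      by (rule sum.cong) (use i in \<open>auto simp: e_dual_e\<close>)
    finally show ?thesis
      using i by simp
  qed
  then show ?thesis
    by (subst x) simp
qed

lemma functional_expansion: "f \<in> D \<Longrightarrow> f x = (\<Sum>i=1..n. e_dual i x * f (e i))"
  by (subst expansion[of x], subst A.functional_sum) auto

lemma r_eq: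
  assumes "\<phi> \<in> DW" "\<psi> \<in> DW"
  shows "r \<phi> \<psi> = (\<Sum>i=1..n. \<phi> (e i, 0) * \<psi> (0, e_dual i) - \<phi> (0, e_dual i) * \<psi> (e i, 0))"
  using assms by (simp add: r_def sum_fun_apply tensor2_def)

lemma skew_r: "skew_symmetric_tensor r"
  unfolding skew_symmetric_tensor_def r_def sum_fun_apply sum_negf[symmetric]
  by (intro allI sum.cong) (auto simp: tensor2_def)

text \<open>\<open>tensor_square\<close> asks for a plain sum of elementary tensors indexed from 0.
  The \<open>n\<close> subtracted terms are therefore listed after the first \<open>n\<close>, with
  the sign moved into their second factor.\<close>

lemma tensor_square_r: "r \<in> tensor_square sW W"
proof -
  have split: "(\<Sum>i<k + m. F i) = (\<Sum>i<k. F i) + (\<Sum>i<m. F (k + i))"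
    for k m and F :: "nat \<Rightarrow> 'c::comm_monoid_add"
    by (induction m) (auto simp: add_ac)
  define a where "a i = (if i < n then (e (Suc i), 0) else (0, e_dual (Suc (i - n))))" for i
  define b where "b i = (if i < n then (0, e_dual (Suc i)) else (- e (Suc (i - n)), 0))" for i
  have "(\<Sum>i<n + n. tensor2 sW W (a i) (b i)) =
      (\<Sum>i<n. tensor2 sW W (e (Suc i), 0) (0, e_dual (Suc i)) +
        tensor2 sW W (0, e_dual (Suc i)) (- e (Suc i), 0))"
    by (simp add: split sum.distrib a_def b_def)
  also have "\<dots> = (\<Sum>i<n. tensor2 sW W (e (Suc i), 0) (0, e_dual (Suc i)) -
        tensor2 sW W (0, e_dual (Suc i)) (e (Suc i), 0))"
  proof (rule sum.cong[OF refl])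
    fix i
    \<comment> \<open>The sign passes through a functional in \<open>DW\<close>; for all other
      arguments both tensors are 0 by convention.\<close>
    have neg: "\<phi> (- e (Suc i), 0) = - \<phi> (e (Suc i), 0)" if "\<phi> \<in> DW" for \<phi>
      using W.functional_neg[OF that, of "(e (Suc i), 0)"] by (simp add: mem_W D_zero)
    have "tensor2 sW W (0, e_dual (Suc i)) (- e (Suc i), 0) =
        - tensor2 sW W (0, e_dual (Suc i)) (e (Suc i), 0)"
    proof (intro ext)
      fix \<phi> \<psi>
      show "tensor2 sW W (0, e_dual (Suc i)) (- e (Suc i), 0) \<phi> \<psi> =
          (- tensor2 sW W (0, e_dual (Suc i)) (e (Suc i), 0)) \<phi> \<psi>"
        using neg[of \<psi>] by (simp add: tensor2_def)
    qed
    then show "tensor2 sW W (e (Suc i), 0) (0, e_dual (Suc i)) +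
        tensor2 sW W (0, e_dual (Suc i)) (- e (Suc i), 0) =
        tensor2 sW W (e (Suc i), 0) (0, e_dual (Suc i)) -
        tensor2 sW W (0, e_dual (Suc i)) (e (Suc i), 0)"
      by simp
  qed
  also have "\<dots> = r"
    unfolding r_def by (rule sum.reindex_bij_witness[of _ "\<lambda>i. i - 1" Suc]) auto
  finally have "tensor_decomp sW W r (n + n) a b"
    by (auto simp: tensor_decomp_def a_def b_def mem_W D_zero e_dual_D)
  then show ?thesis
    by (auto simp: tensor_square_def)
qed

section \<open>The map given by \<open>r\<close> and its inverse\<close>

lemma pairing_DW:
  assumes "u \<in> W"
  shows "pairing u \<in> DW"
proof -
  obtain x a where u: "u = (x, a)" "a \<in> D"
    using assms by (auto simp: sum_carrier_def)
  then show ?thesis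
    by (auto simp: dual_space_def[of sW] pairing_def sum_carrier_def D_add D_scale sum_scale_def
        functional algebra_simps)
qed

text \<open>In \<open>W\<close>, \<open>(x, a)\<close> is the combination of the
  \<open>(e i, 0)\<close> with coefficients \<open>e_dual i x\<close> and of the
  \<open>(0, e_dual i)\<close> with coefficients \<open>a (e i)\<close>.\<close>

lemma DW_expansion:
  assumes \<phi>: "\<phi> \<in> DW" and a: "a \<in> D"
  shows "\<phi> (x, a) = (\<Sum>i=1..n. e_dual i x * \<phi> (e i, 0)) + (\<Sum>i=1..n. a (e i) * \<phi> (0, e_dual i))"
proof -
  have "(\<Sum>i=1..n. sW (e_dual i x) (e i, 0)) = (x, 0)"
    by (subst (2) expansion[of x])
      (auto simp: prod_eq_iff fst_sum snd_sum sum_scale_def sum_fun_apply fun_eq_iff)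
  moreover have "(\<Sum>i=1..n. a (e i) * e_dual i y) = a y" for y
    using functional_expansion[OF a, of y] by (simp add: mult.commute)
  then have "(\<Sum>i=1..n. sW (a (e i)) (0, e_dual i)) = (0, a)"
    by (auto simp: prod_eq_iff fst_sum snd_sum sum_scale_def sum_fun_apply fun_eq_iff)
  moreover have "\<phi> (x, a) = \<phi> (x, 0) + \<phi> (0, a)"
    using dual_spaceD(1)[OF \<phi>, of "(x, 0)" "(0, a)"] a by (simp add: mem_W D_zero)
  moreover have "\<phi> (\<Sum>i=1..n. sW (e_dual i x) (e i, 0)) = (\<Sum>i=1..n. e_dual i x * \<phi> (e i, 0))"
    by (rule W.functional_sum[OF \<phi>]) (simp add: mem_W D_zero)
  moreover have "\<phi> (\<Sum>i=1..n. sW (a (e i)) (0, e_dual i)) = (\<Sum>i=1..n. a (e i) * \<phi> (0, e_dual i))"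
    by (rule W.functional_sum[OF \<phi>]) (simp add: mem_W e_dual_D)
  ultimately show ?thesis
    by simp
qed

lemma pairing_surj:
  assumes \<phi>: "\<phi> \<in> DW"
  obtains u where "u \<in> W" "\<phi> = pairing u"
proof
  \<comment> \<open>\<open>pairing u (y, b)\<close> is \<open>b (fst u) - snd u y\<close>.
    Comparison at \<open>(y, 0)\<close> forces the second component, comparison at
    \<open>(0, e_dual i)\<close> the coefficient of \<open>e i\<close> in the first.\<close>
  let ?u = "(\<Sum>i=1..n. s (\<phi> (0, e_dual i)) (e i), \<lambda>y. - \<phi> (y, 0))"
  have add: "\<phi> (x, 0) + \<phi> (y, 0) = \<phi> (x + y, 0)" for x y
    using dual_spaceD(1)[OF \<phi>, of "(x, 0)" "(y, 0)"] by (simp add: mem_W D_zero)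
  have scale: "\<phi> (s c x, 0) = c * \<phi> (x, 0)" for c x
    using dual_spaceD(2)[OF \<phi>, of "(x, 0)" c]
    by (simp add: mem_W D_zero sum_scale_def flip: zero_fun_def)
  show "?u \<in> W"
    by (auto simp: mem_W dual_space_def add[symmetric] scale)
  show "\<phi> = pairing ?u"
  proof
    fix v
    show "\<phi> v = pairing ?u v"
    proof (cases "v \<in> W")
      case False
      then show ?thesis
        using \<phi> by (cases v) (auto simp: pairing_def dual_space_def)
    next
      case True
      then obtain y b where v: "v = (y, b)" and b: "b \<in> D"
        by (auto simp: sum_carrier_def)
      have "\<phi> (y, 0) = (\<Sum>i=1..n. e_dual i y * \<phi> (e i, 0))"
        using DW_expansion[OF \<phi> D_zero, of y] by simp
      then show ?thesis
        using True b DW_expansion[OF \<phi> b, of y]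
        by (simp add: v pairing_def A.functional_sum[OF b] mult.commute)
    qed
  qed
qed

text \<open>\<open>pairing u\<close> is \<open>e_dual i x\<close> at \<open>(0, e_dual i)\<close>
  and \<open>- a (e i)\<close> at \<open>(e i, 0)\<close>. The latter sign cancels the one in
  \<open>r\<close>, leaving the sum in \<open>DW_expansion\<close>.\<close>

lemma r_pairing:
  assumes "\<phi> \<in> DW" "u \<in> W"
  shows "\<phi> u = r \<phi> (pairing u)"
proof -
  obtain x a where u: "u = (x, a)" and a: "a \<in> D"
    using assms by (auto simp: sum_carrier_def)
  have "r \<phi> (pairing u) = (\<Sum>i=1..n. \<phi> (e i, 0) * e_dual i x + \<phi> (0, e_dual i) * a (e i))"
    unfolding r_eq[OF assms(1) pairing_DW[OF assms(2)]]
    by (rule sum.cong) (auto simp: pairing_def u mem_W D_zero e_dual_D A.functional_zero[OF a]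
        A.functional_zero[OF e_dual_D])
  then show ?thesis
    by (simp add: u DW_expansion[OF assms(1) a] sum.distrib mult.commute)
qed

text \<open>\<open>pairing (x, 0)\<close> reads off the second component at \<open>x\<close>, and
  \<open>pairing (0, e_dual i)\<close> minus the coordinate \<open>e_dual i\<close> of the
  first.\<close>

lemma separating:
  assumes "w \<in> W" "\<And>\<phi>. \<phi> \<in> DW \<Longrightarrow> \<phi> w = 0"
  shows "w = 0"
proof -
  obtain y b where w: "w = (y, b)" and b: "b \<in> D"
    using assms by (auto simp: sum_carrier_def)
  have "b x = 0" for x
    using assms(2)[OF pairing_DW, of "(x, 0)"] b by (simp add: pairing_def mem_W D_zero w)
  moreover have "e_dual i y = 0" if "i \<in> {1..n}" for i
    using assms(2)[OF pairing_DW, of "(0, e_dual i)"] b e_dual_D[OF that]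
    by (simp add: pairing_def mem_W w A.functional_zero)
  then have "y = 0"
    by (subst expansion) simp
  ultimately show ?thesis
    by (auto simp: w zero_prod_def)
qed

text \<open>\<open>r_pairing\<close> is the condition under \<open>THE\<close>, and
  \<open>separating\<close> gives uniqueness.\<close>

lemma tensor_map_pairing:
  assumes u: "u \<in> W"
  shows "tensor_map sW W r (pairing u) = u"
  unfolding tensor_map_def
proof (rule the_equality)
  show "u \<in> W \<and> (\<forall>\<phi>\<in>DW. \<phi> u = r \<phi> (pairing u))"
    using u r_pairing by blast
  fix w assume w: "w \<in> W \<and> (\<forall>\<phi>\<in>DW. \<phi> w = r \<phi> (pairing u))"
  have "w - u = 0"
  proof (rule separating)
    show "w - u \<in> W"
      using w u W.subspace_diff[OF W.subspace] by blast
    fix \<phi> assume "\<phi> \<in> DW"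
    then show "\<phi> (w - u) = 0"
      using w u r_pairing by (simp add: W.functional_diff)
  qed
  then show "w = u" by simp
qed

text \<open>\<open>pairing\<close> is a right inverse by \<open>tensor_map_pairing\<close>; since
  every element of \<open>DW\<close> is some \<open>pairing u\<close>, it is also a left
  inverse.\<close>

lemma bij_tensor_map: "bij_betw (tensor_map sW W r) DW W"
proof (rule bij_betw_byWitness[where f' = pairing])
  show "\<forall>\<phi>\<in>DW. pairing (tensor_map sW W r \<phi>) = \<phi>"
    by (metis pairing_surj tensor_map_pairing)
  show "tensor_map sW W r ` DW \<subseteq> W"
    by (metis image_subsetI pairing_surj tensor_map_pairing)
qed (auto simp: tensor_map_pairing pairing_DW)

lemma inv_tensor_map: "u \<in> W \<Longrightarrow> inv_into DW (tensor_map sW W r) u = pairing u"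
  using inv_into_f_f[OF bij_betw_imp_inj_on[OF bij_tensor_map] pairing_DW, of u]
  by (simp add: tensor_map_pairing)

text \<open>The formula for the cocycle in the claim, in the form that the cocycle lemmas below take
  as hypothesis.\<close>

lemma inv_tensor_map_eq:
  "a \<in> D \<Longrightarrow> b \<in> D \<Longrightarrow> inv_into DW (tensor_map sW W r) (x, a) (y, b) = - a y + b x"
  by (simp add: inv_tensor_map mem_W pairing_def)

lemma LD_solution_if_two_cocycle:
  assumes "bilinear_on sW W sW W p" "bilinear_on sW W sW W q"
    and "two_cocycle sW W p q (\<lambda>u v. inv_into DW (tensor_map sW W r) u v)"
  shows "LD_solution sW W p q r"
  unfolding LD_solution_def
proof
  show "LD_equation sW W p q r"
  proof (rule W.LD_equation_if_two_cocycle[OF assms(1,2) separating skew_r _ _ _ assms(3)])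
    fix \<psi> assume \<psi>: "\<psi> \<in> DW"
    show T: "tensor_map sW W r \<psi> \<in> W"
      using bij_tensor_map \<psi> by (auto simp: bij_betw_def)
    show "\<phi> (tensor_map sW W r \<psi>) = r \<phi> \<psi>" if "\<phi> \<in> DW" for \<phi>
      using \<psi> that by (metis pairing_surj tensor_map_pairing r_pairing)
    show "inv_into DW (tensor_map sW W r) (tensor_map sW W r \<psi>) v = \<psi> v" for v
      using inv_into_f_f[OF bij_betw_imp_inj_on[OF bij_tensor_map] \<psi>] by simp
  qed
qed (rule tensor_square_r)

end


section \<open>L-quadri-algebras\<close>

text \<open>Nested, this builds signed sums of axioms: an instance taken \<open>symmetric\<close>
  enters with the opposite sign.\<close>

lemma eq_add: "a = b \<Longrightarrow> c = d \<Longrightarrow> a + c = b + (d :: 'a::ab_group_add)"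
  by simp

locale L_quadri = dual_sum s for s :: "'k::field \<Rightarrow> 'a::ab_group_add \<Rightarrow> 'a" +
  fixes se ne nw sw :: "'a \<Rightarrow> 'a \<Rightarrow> 'a"
  assumes quadri: "L_quadri_algebra s se ne nw sw"
begin

abbreviation "succ \<equiv> quadri_succ se ne nw sw"
abbreviation "prec \<equiv> quadri_prec se ne nw sw"
abbreviation "vee \<equiv> quadri_vee se ne nw sw"
abbreviation "wedge \<equiv> quadri_wedge se ne nw sw"
abbreviation "ast \<equiv> quadri_ast se ne nw sw"
abbreviation "tr \<equiv> quadri_right se ne nw sw"
abbreviation tl where "tl \<equiv> quadri_left se ne nw sw"
abbreviation "circ \<equiv> ld_circ tr tl"
abbreviation "bullet \<equiv> ld_bullet tr tl"

lemmas product_defs = quadri_succ_def quadri_prec_def quadri_vee_def quadri_wedge_def quadri_ast_def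
  quadri_right_def quadri_left_def ld_circ_def ld_bullet_def

lemma bilinear: "bilinear_on s UNIV s UNIV se" "bilinear_on s UNIV s UNIV ne"
    "bilinear_on s UNIV s UNIV nw" "bilinear_on s UNIV s UNIV sw"
  using quadri by (auto simp: L_quadri_algebra_def Let_def)

lemma add:
  "se (x + y) z = se x z + se y z" "se x (y + z) = se x y + se x z"
  "ne (x + y) z = ne x z + ne y z" "ne x (y + z) = ne x y + ne x z"
  "nw (x + y) z = nw x z + nw y z" "nw x (y + z) = nw x y + nw x z"
  "sw (x + y) z = sw x z + sw y z" "sw x (y + z) = sw x y + sw x z"
  using bilinear by (auto simp: bilinear_on_def)

lemma minus:
  "se (- x) z = - se x z" "se x (- z) = - se x z"
  "ne (- x) z = - ne x z" "ne x (- z) = - ne x z"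
  "nw (- x) z = - nw x z" "nw x (- z) = - nw x z"
  "sw (- x) z = - sw x z" "sw x (- z) = - sw x z"
  by (rule additive.minus, simp add: additive_def add)+

lemma diff:
  "se (x - y) z = se x z - se y z" "se x (y - z) = se x y - se x z"
  "ne (x - y) z = ne x z - ne y z" "ne x (y - z) = ne x y - ne x z"
  "nw (x - y) z = nw x z - nw y z" "nw x (y - z) = nw x y - nw x z"
  "sw (x - y) z = sw x z - sw y z" "sw x (y - z) = sw x y - sw x z"
  unfolding diff_conv_add_uminus by (simp_all only: add minus)

lemma
  ax1: "se x (se y z) - se (ast x y) z = se y (se x z) - se (ast y x) z" and
  ax2: "se x (ne y z) - ne (vee x y) z = ne y (succ x z) - ne (wedge y x) z" and
  ax3: "se x (nw y z) - nw (se x y) z = nw y (ast x z) - nw (nw y x) z" and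
  ax4: "ne x (prec y z) - nw (ne x y) z = sw y (wedge x z) - nw (sw y x) z" and
  ax5: "se x (sw y z) - sw (succ x y) z = sw y (vee x z) - sw (prec y x) z"
  using quadri unfolding L_quadri_algebra_def Let_def by blast+

text \<open>Reduces everything to sums of nested values of the four basic products, so that a
  combination of axioms is compared with its goal by cancellation.\<close>

lemmas expand = product_defs add minus diff algebra_simps

lemma bilinear_products: "bilinear_on s UNIV s UNIV succ" "bilinear_on s UNIV s UNIV prec"
    "bilinear_on s UNIV s UNIV vee" "bilinear_on s UNIV s UNIV wedge"
    "bilinear_on s UNIV s UNIV ast" "bilinear_on s UNIV s UNIV tr" "bilinear_on s UNIV s UNIV tl"
    "bilinear_on s UNIV s UNIV circ" "bilinear_on s UNIV s UNIV bullet"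
  unfolding product_defs[abs_def]
  by (intro bilinear_on_add bilinear_on_diff bilinear bilinear[THEN bilinear_on_flip]
      vector_space_axioms subspace_UNIV)+

lemmas bilinear_intros = bilinear bilinear_products bilinear[THEN bilinear_on_flip]
  bilinear_products[THEN bilinear_on_flip] bilinear_on_uminus[OF vector_space_axioms subspace_UNIV]

lemmas rep_simps = dual_rep_def left_mult_def right_mult_def functional fun_eq_iff

section \<open>The horizontal semidirect product\<close>

sublocale horizontal: dual_semidirect s tr tl ast
  "\<lambda>x y. - nw x y" "\<lambda>x y. - wedge x y" prec
  "dual_rep (left_mult ast)" "- dual_rep (left_mult nw)"
  "- dual_rep (left_mult wedge)" "dual_rep (left_mult prec)"
  by unfold_locales (auto intro: bilinear_intros simp: rep_simps)

lemma horizontal_L_dendriform: "L_dendriform_algebra s UNIV tr tl"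
  unfolding L_dendriform_algebra_def
proof (intro conjI ballI vector_space_axioms subspace_UNIV bilinear_products)
  fix x y z
  show "tr x (tr y z) - tr (ld_bullet tr tl x y) z =
      tr y (tr x z) - tr (ld_bullet tr tl y x) z"
    \<comment> \<open>\<open>tr\<close> and \<open>tl\<close> reverse the arguments of
      \<open>nw\<close> and \<open>sw\<close>, so \<open>ax3\<close>, \<open>ax4\<close> and
      \<open>ax5\<close> are instantiated with \<open>z\<close> in the middle.\<close>
    using eq_add[OF ax1[of x y z] eq_add[OF ax3[of x z y, symmetric] ax3[of y z x]]]
    by (simp add: expand)
  show "tr x (tl y z) - tl (tr x y) z = tl y (ld_bullet tr tl x z) - tl (tl y x) z"
    using eq_add[OF ax2[of x y z] eq_add[OF ax5[of x z y, symmetric] ax4[of y z x]]]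
    by (simp add: expand)
qed

lemma horizontal_semidirect: "L_dendriform_algebra sW W horizontal.P horizontal.Q"
proof (rule horizontal.L_dendriform[OF horizontal_L_dendriform], goal_cases)
  \<comment> \<open>\<open>bullet\<close> and \<open>ast\<close> have the same commutator, so
    \<open>C1\<close> says that \<open>ast\<close> is left-symmetric. \<open>ax1\<close> is already
    symmetric in \<open>x\<close> and \<open>y\<close> and occurs once; the other axioms occur for
    both orders, with opposite signs.\<close>
  case (1 x y u)
  show ?case
    using eq_add[OF ax1[of x y u, symmetric] eq_add[OF ax2[of x y u, symmetric]
      eq_add[OF ax3[of x y u, symmetric] eq_add[OF ax4[of x y u, symmetric]
      eq_add[OF ax5[of x y u, symmetric] eq_add[OF ax2[of y x u] eq_add[OF ax3[of y x u]
      eq_add[OF ax4[of y x u] ax5[of y x u]]]]]]]]]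
    by (simp add: expand)
next
  case (2 y z u)
  show ?case
    using ax3[of y z u, symmetric]
    by (simp add: expand)
next
  case (3 x y u)
  show ?case
    using eq_add[OF ax2[of x y u] eq_add[OF ax3[of x y u] ax4[of y x u, symmetric]]]
    by (simp add: expand)
next
  case (4 x z u)
  show ?case
    using eq_add[OF ax3[of x z u, symmetric] eq_add[OF ax4[of x z u, symmetric]
      ax5[of x z u, symmetric]]]
    by (simp add: expand)
next
  case (5 y z u)
  show ?case
    using ax4[of y z u, symmetric]
    by (simp add: expand)
qed

text \<open>\<open>K1\<close>, \<open>K2\<close>, \<open>K3\<close> become linear identities in the
  four products, true by the definitions of the derived products.\<close>

lemma horizontal_two_cocycle:
  assumes "\<And>x y a b. a \<in> D \<Longrightarrow> b \<in> D \<Longrightarrow> B (x, a) (y, b) = - a y + b x"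
  shows "two_cocycle sW W horizontal.P horizontal.Q B"
  by (rule horizontal.two_cocycle[OF _ _ _ assms]) (simp_all add: expand)

section \<open>The vertical semidirect product\<close>

sublocale vertical: dual_semidirect s succ prec circ
  "\<lambda>x y. ne y x" "\<lambda>x y. tl y x" "\<lambda>x y. - wedge y x"
  "dual_rep (left_mult circ)" "dual_rep (right_mult ne)"
  "dual_rep (right_mult tl)" "- dual_rep (right_mult wedge)"
  by unfold_locales (auto intro: bilinear_intros simp: rep_simps)

lemma vertical_L_dendriform: "L_dendriform_algebra s UNIV succ prec"
  unfolding L_dendriform_algebra_def
proof (intro conjI ballI vector_space_axioms subspace_UNIV bilinear_products)
  fix x y z
  show "succ x (succ y z) - succ (ld_bullet succ prec x y) z =
      succ y (succ x z) - succ (ld_bullet succ prec y x) z"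
    using eq_add[OF ax1[of x y z] eq_add[OF ax2[of x y z] ax2[of y x z, symmetric]]]
    by (simp add: expand)
  show "succ x (prec y z) - prec (succ x y) z = prec y (ld_bullet succ prec x z) - prec (prec y x) z"
    using eq_add[OF ax3[of x y z] eq_add[OF ax4[of x y z] ax5[of x y z]]]
    by (simp add: expand)
qed

lemma vertical_semidirect: "L_dendriform_algebra sW W vertical.P vertical.Q"
proof (rule vertical.L_dendriform[OF vertical_L_dendriform], goal_cases)
  \<comment> \<open>\<open>circ x y\<close> is \<open>vee x y - wedge y x\<close> and has the
    commutator of \<open>ast\<close>, so \<open>C1\<close> is left-symmetry of \<open>circ\<close>.
    The reversed \<open>wedge\<close> is what moves \<open>u\<close> to earlier places in some of
    the axioms.\<close>
  case (1 x y u)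
  show ?case
    using eq_add[OF ax1[of x y u, symmetric] eq_add[OF ax5[of x y u, symmetric]
      eq_add[OF ax2[of x u y] eq_add[OF ax3[of x u y] eq_add[OF ax5[of y x u]
      eq_add[OF ax2[of y u x, symmetric] eq_add[OF ax3[of y u x, symmetric]
      eq_add[OF ax4[of u x y, symmetric] ax4[of u y x]]]]]]]]]
    by (simp add: expand)
next
  \<comment> \<open>\<open>\<beta>\<close> is a right multiplication here, so \<open>u\<close> takes
    the middle place in the axiom.\<close>
  case (2 y z u)
  show ?case
    using ax2[of y u z]
    by (simp add: expand)
next
  case (3 x y u)
  show ?case
    using eq_add[OF ax5[of x y u] eq_add[OF ax2[of x u y, symmetric] ax4[of u y x, symmetric]]]
    by (simp add: expand)
next
  case (4 x z u)
  show ?case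
    using eq_add[OF ax2[of x u z] eq_add[OF ax3[of x u z] ax4[of u x z, symmetric]]]
    by (simp add: expand)
next
  case (5 y z u)
  show ?case
    using ax4[of u y z, symmetric]
    by (simp add: expand)
qed

lemma vertical_two_cocycle:
  assumes "\<And>x y a b. a \<in> D \<Longrightarrow> b \<in> D \<Longrightarrow> B (x, a) (y, b) = - a y + b x"
  shows "two_cocycle sW W vertical.P vertical.Q B"
  by (rule vertical.two_cocycle[OF _ _ _ assms]) (simp_all add: expand)

section \<open>The depth semidirect product\<close>

sublocale depth: dual_semidirect s vee wedge bullet
  "\<lambda>x y. sw y x" "\<lambda>x y. - tl x y" "\<lambda>x y. - prec y x"
  "dual_rep (left_mult bullet)" "dual_rep (right_mult sw)"
  "- dual_rep (left_mult tl)" "- dual_rep (right_mult prec)"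
  by unfold_locales (auto intro: bilinear_intros simp: rep_simps)

lemma depth_L_dendriform: "L_dendriform_algebra s UNIV vee wedge"
  unfolding L_dendriform_algebra_def
proof (intro conjI ballI vector_space_axioms subspace_UNIV bilinear_products)
  fix x y z
  show "vee x (vee y z) - vee (ld_bullet vee wedge x y) z =
      vee y (vee x z) - vee (ld_bullet vee wedge y x) z"
    using eq_add[OF ax1[of x y z] eq_add[OF ax5[of x y z] ax5[of y x z, symmetric]]]
    by (simp add: expand)
  show "vee x (wedge y z) - wedge (vee x y) z = wedge y (ld_bullet vee wedge x z) - wedge (wedge y x) z"
    using eq_add[OF ax2[of x y z] eq_add[OF ax3[of x y z] ax4[of y x z, symmetric]]]
    by (simp add: expand)
qed

lemma depth_semidirect: "L_dendriform_algebra sW W depth.P depth.Q"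
proof (rule depth.L_dendriform[OF depth_L_dendriform], goal_cases)
  \<comment> \<open>\<open>C1\<close> is now left-symmetry of \<open>bullet\<close>, where
    \<open>bullet x y\<close> is \<open>succ x y - prec y x\<close> and the commutator is again that
    of \<open>ast\<close>.\<close>
  case (1 x y u)
  show ?case
    using eq_add[OF ax1[of x y u, symmetric] eq_add[OF ax2[of x y u, symmetric]
      eq_add[OF ax3[of x u y] eq_add[OF ax4[of x u y] eq_add[OF ax5[of x u y]
      eq_add[OF ax2[of y x u] eq_add[OF ax3[of y u x, symmetric]
      eq_add[OF ax4[of y u x, symmetric] ax5[of y u x, symmetric]]]]]]]]]
    by (simp add: expand)
next
  case (2 y z u)
  show ?case
    using ax5[of y u z]
    by (simp add: expand)
next
  case (3 x y u)
  show ?case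
    using eq_add[OF ax2[of x y u] eq_add[OF ax5[of x u y, symmetric] ax4[of y u x]]]
    by (simp add: expand)
next
  case (4 x z u)
  show ?case
    using eq_add[OF ax3[of x u z] eq_add[OF ax4[of x u z] ax5[of x u z]]]
    by (simp add: expand)
next
  case (5 y z u)
  show ?case
    using ax4[of y u z]
    by (simp add: expand)
qed

lemma depth_two_cocycle:
  assumes "\<And>x y a b. a \<in> D \<Longrightarrow> b \<in> D \<Longrightarrow> B (x, a) (y, b) = - a y + b x"
  shows "two_cocycle sW W depth.P depth.Q B"
  by (rule depth.two_cocycle[OF _ _ _ assms]) (simp_all add: expand)

end

section \<open>The three semidirect products together\<close>

theorem corollary3p22:
  fixes s :: "'k::field_char_0 \<Rightarrow> 'a::ab_group_add \<Rightarrow> 'a"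
    and se ne nw sw :: "'a \<Rightarrow> 'a \<Rightarrow> 'a"
    and n :: nat and e :: "nat \<Rightarrow> 'a" and e_dual :: "nat \<Rightarrow> 'a \<Rightarrow> 'k"
  assumes "L_quadri_algebra s se ne nw sw"
    and "inj_on e {1..n}"
    and "finite_dimensional_vector_space s (e ` {1..n})"
    and "\<forall>i\<in>{1..n}. e_dual i \<in> dual_space s UNIV"
    and "\<forall>i\<in>{1..n}. \<forall>j\<in>{1..n}. e_dual i (e j) = (if i = j then 1 else 0)"
  shows
    "let succ = quadri_succ se ne nw sw; prec = quadri_prec se ne nw sw;
         vee = quadri_vee se ne nw sw; wedge = quadri_wedge se ne nw sw;
         ast = quadri_ast se ne nw sw;
         tr = quadri_right se ne nw sw; tl = quadri_left se ne nw sw;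
         circ = ld_circ tr tl; bullet = ld_bullet tr tl;
         sW = sum_scale s; W = sum_carrier s;
         r = (\<Sum>i=1..n. tensor2 sW W (e i, 0) (0, e_dual i) - tensor2 sW W (0, e_dual i) (e i, 0));
         B = (\<lambda>u v. inv_into (dual_space sW W) (tensor_map sW W r) u v);
         hor = (semidirect_prod tr (dual_rep (left_mult ast)) (- dual_rep (left_mult nw)),
                semidirect_prod tl (- dual_rep (left_mult wedge)) (dual_rep (left_mult prec)));
         ver = (semidirect_prod succ (dual_rep (left_mult circ)) (dual_rep (right_mult ne)),
                semidirect_prod prec (dual_rep (right_mult tl)) (- dual_rep (right_mult wedge)));
         dep = (semidirect_prod vee (dual_rep (left_mult bullet)) (dual_rep (right_mult sw)),
                semidirect_prod wedge (- dual_rep (left_mult tl)) (- dual_rep (right_mult prec)))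
     in skew_symmetric_tensor r \<and>
        bij_betw (tensor_map sW W r) (dual_space sW W) W \<and>
        (\<forall>(p, q)\<in>{hor, ver, dep}.
           L_dendriform_algebra sW W p q \<and> LD_solution sW W p q r \<and> two_cocycle sW W p q B) \<and>
        (\<forall>x y. \<forall>a\<in>dual_space s UNIV. \<forall>b\<in>dual_space s UNIV. B (x, a) (y, b) = - a y + b x)"
proof -
  interpret fin: finite_dimensional_vector_space s "e ` {1..n}" by fact
  interpret L_quadri s se ne nw sw
    by unfold_locales fact
  interpret dual_basis s n e e_dual
    by unfold_locales (use assms(2,4,5) fin.span_Basis in auto)
  let ?B = "\<lambda>u v. inv_into DW (tensor_map sW W r) u v"
  \<comment> \<open>The closed formula makes the same form a cocycle in all three algebras, and each
    cocycle in turn yields the LD-equation.\<close>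
  note cocycles = horizontal_two_cocycle[OF inv_tensor_map_eq]
    vertical_two_cocycle[OF inv_tensor_map_eq] depth_two_cocycle[OF inv_tensor_map_eq]
  have main: "L_dendriform_algebra sW W p q \<and> LD_solution sW W p q r \<and> two_cocycle sW W p q ?B"
    if "(p, q) \<in> {(horizontal.P, horizontal.Q), (vertical.P, vertical.Q), (depth.P, depth.Q)}" for p q
    using that horizontal_semidirect vertical_semidirect depth_semidirect cocycles
      LD_solution_if_two_cocycle[OF horizontal.bilinear_P horizontal.bilinear_Q cocycles(1)]
      LD_solution_if_two_cocycle[OF vertical.bilinear_P vertical.bilinear_Q cocycles(2)]
      LD_solution_if_two_cocycle[OF depth.bilinear_P depth.bilinear_Q cocycles(3)]
    by blast
  show ?thesis
    unfolding Let_def r_def[symmetric]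
    using skew_r bij_tensor_map main inv_tensor_map_eq by blast
qed

end
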